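(* Let $m\geq 3$, $s\in\{0,\ldots,m\}$, $k\in\mathbb{N}_0$, let $(\nu,\mu)\in I^{s,m}_k$ with $\nu=(s_{m-1},\ldots,s_3,t_2)$, $\mu=(k_{m-1},\ldots,k_3,k_2)$ and $s_2=|t_2|$, and let $$f^{s,\nu}_{k,\mu}=X^{s,s_{m-1},m}_{k,k_{m-1}}\,X^{s_{m-1},s_{m-2},m-1}_{k_{m-1},k_{m-2}}\cdots X^{s_3,s_2,3}_{k_3,k_2}\,f^{t_2}_{k_2}.$$ Then: (i) $\partial_{x_m}f^{s,\nu}_{k,\mu}=0$ if $k=k_{m-1}$; (ii) $\partial_{x_m}f^{s,\nu}_{k,\mu}=k\,f^{s,\nu}_{k-1,\mu}$ if $k>k_{m-1}$; (iii) $\partial_{t_2}^{k_2}\,\partial_{x_3}^{k_3-k_2}\cdots\partial_{x_m}^{k-k_{m-1}}\,f^{s,\nu}_{k,\mu}=k!\,e^{s,\nu}$, where $e^{s,\nu}=e_m^{s-s_{m-1}}\cdots e_3^{s_3-s_2}\,e^{s_2,t_2}$ and, for $t_2=\pm1$, $$\partial_{t_2}=\begin{cases}\frac12(\partial_{x_1}+e_1e_2\,\partial_{x_2}) & \text{if }\mathcal{C}\ell_m=\mathbb{R}_{0,m},\\[2pt] \frac12(\partial_{x_1}\pm i\,\partial_{x_2}) & \text{if }\mathcal{C}\ell_m=\mathbb{C}_m,\end{cases}$$ while for $t_2\in\{0,2\}$ one has $k_2=0$ and the factor $\partial_{t_2}^{k_2}$ is the identity.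
   Context: Clifford algebra. $e_1,\ldots,e_m$ is the standard orthonormal basis of $\mathbb{R}^m$; $\mathcal{C}\ell_m$ denotes either the real Clifford algebra $\mathbb{R}_{0,m}$ with $e_ie_j+e_je_i=-2\delta_{ij}$ or its complexification $\mathbb{C}_m$ (the same choice throughout). For $r\le m$, $\mathcal{C}\ell_{r}\subset\mathcal{C}\ell_m$ is generated by $e_1,\ldots,e_{r}$; its $s$-vectors are the elements of the span of the products $e_{i_1}\cdots e_{i_s}$ with $i_1<\cdots<i_s\le r$. For a 1-vector $u$ and an $s$-vector $v$: $u\bullet v=\frac12(uv-(-1)^svu)$ and $u\wedge v=\frac12(uv+(-1)^svu)$, extended linearly in $v$; $(u\,\wedge)$ and $(u\,\bullet)$ are the operators $v\mapsto u\wedge v$, $v\mapsto u\bullet v$. All other products are left Clifford multiplications, and operators are composed from right to left. Index sets. For $r\ge3$, $0\le s\le r$, $k\in\mathbb{N}_0$, $N^{s,r}_k$ is the set of pairs $(t,j)\in\{0,\ldots,r-1\}\times\{0,\ldots,k\}$ such that $t\in\{s-1,s\}$ and such that $j=0$ whenever $t\in\{0,r-1\}$; except that $N^{s,r}_k=\emptyset$ if $s\in\{0,r\}$ and $k\ge1$. $I^{s,m}_k$ is the set of pairs $(\nu,\mu)$ of integer sequences $\nu=(s_{m-1},\ldots,s_3,t_2)$, $\mu=(k_{m-1},\ldots,k_3,k_2)$ such that $(t_2,k_2)\in\{(0,0),(2,0)\}\cup\{(\pm1,l)\,|\,l\in\mathbb{N}_0\}$ and, for each $r=3,\ldots,m$,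 $(s_{r-1},k_{r-1})\in N^{s_r,r}_{k_r}$, where $k_m=k$, $s_m=s$, $s_2=|t_2|$. Embedding factors. Let $r\ge 3$, $x=(x_1,\ldots,x_r)\in\mathbb{R}^r$, $\underline{x}=x_1e_1+\cdots+x_{r-1}e_{r-1}$. For integers $j,n\ge0$ put $$F^{(n)}_{r,j}(x)=\frac{(j+1)_{n}}{(r-2+2j)_{n}}\,|x|^{n}\,C^{r/2+j-1}_{n}(x_r/|x|),\qquad F^{(-1)}_{r,j}=0,$$ where $(\nu)_n=\nu(\nu+1)\cdots(\nu+n-1)$ and $C^\nu_n(z)=\sum_{i=0}^{[n/2]}\frac{(-1)^i(\nu)_{n-i}}{i!(n-2i)!}(2z)^{n-2i}$ (Gegenbauer polynomial), and $$X^{(n)}_{r,j}(x)=F^{(n)}_{r,j}(x)+\frac{j+1}{r+2j-1}F^{(n-1)}_{r,j+1}(x)\,\underline{x}\,e_r,\qquad X^{(-1)}_{r,j}=0.$$ For $(t,j)\in N^{s,r}_k$ define the operator on $\mathcal{C}\ell_{r-1}$-valued polynomials in $(x_1,\ldots,x_{r-1})$ $$X^{s,t,r}_{k,j}=X^{(k-j)}_{r,j}\,e_r^{s-t}+\alpha\,X^{(k-1-j)}_{r,j+1}\bigl(\beta^{t-s}(\underline{x}\,\wedge)+\beta^{t-s+1}(\underline{x}\,\bullet)\bigr)e_r^{s-t+1},$$ with $\beta=-(j+r-1-t)/(j+t)$, $\alpha=-(j+1)/(r+2j-1)$ if $t\notin\{0,r-1\}$ and $\alpha=0$ if $t\in\{0,r-1\}$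 (then the second summand is $0$). Dimension 2. $e^{0,0}=1$, $e^{2,2}=e_2e_1$, $f^0_0=e^{0,0}$, $f^2_0=e^{2,2}$. If $\mathcal{C}\ell_m=\mathbb{R}_{0,m}$: $f^{\pm1}_l(x)=(x_1-e_1e_2x_2)^l\,e^{1,\pm1}$ with $e^{1,1}=e_1$, $e^{1,-1}=e_2$. If $\mathcal{C}\ell_m=\mathbb{C}_m$: $f^{\pm1}_l(x)=(x_1\mp ix_2)^l\,e^{1,\pm1}$ with $e^{1,\pm1}=e_1\mp ie_2$. ($l\in\mathbb{N}_0$.) (The polynomials $f^{s,\nu}_{k,\mu}$, $(\nu,\mu)\in I^{s,m}_k$, are the basis elements of the space of $k$-homogeneous $s$-vector valued polynomials $P$ on $\mathbb{R}^m$ with $(e_1\partial_{x_1}+\cdots+e_m\partial_{x_m})P=0$.) *)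

theory Defs
  imports "HOL-Analysis.Analysis"
begin

section \<open>Clifford algebras with negative definite signature\<close>

text \<open>
  The universal Clifford algebra on countably many anticommuting generators with square
  \<open>-1\<close>, in its canonical basis: an element is a finitely supported family of scalars indexed by
  the finite sets \<open>A\<close> of natural numbers, \<open>A = {i\<^sub>1 < \<dots> < i\<^sub>s}\<close> standing for the product
  \<open>e i\<^sub>1 * \<dots> * e i\<^sub>s\<close> (see \<open>prod_list_e\<close> below). The algebra
  on \<open>m\<close> generators is the subalgebra generated by \<open>e 1, \<dots>, e m\<close>; scalars \<open>real\<close> give
  \<open>\<real>\<^bsub>0,m\<^esub>\<close> and scalars \<open>complex\<close> its complexification.
\<close>

definition symdiff :: "nat set \<Rightarrow> nat set \<Rightarrow> nat set" where
  "symdiff A B = (A - B) \<union> (B - A)"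

text \<open>
  Sorting the product of the blades \<open>A\<close> and \<open>B\<close> costs one sign for every pair \<open>a > b\<close>
  (anticommutation) and one for every pair \<open>a = b\<close> (square \<open>-1\<close>).
\<close>

definition reorder_sign :: "nat set \<Rightarrow> nat set \<Rightarrow> 'k::comm_ring_1" where
  "reorder_sign A B = (\<Prod>a\<in>A. \<Prod>b\<in>B. if b \<le> a then -1 else 1)"

lemma symdiff_simps [simp]:
  "symdiff A {} = A" "symdiff {} A = A" "symdiff A A = {}"
  "symdiff A (symdiff A B) = B"
  by (auto simp: symdiff_def)

lemma symdiff_assoc: "symdiff (symdiff A B) C = symdiff A (symdiff B C)"
  by (auto simp: symdiff_def)

lemma symdiff_commute: "symdiff A B = symdiff B A"
  by (auto simp: symdiff_def)

lemma symdiff_eq_iff: "symdiff A B = C \<longleftrightarrow> B = symdiff A C"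
  by (metis symdiff_simps(4))

lemma finite_symdiff_iff: "finite A \<Longrightarrow> finite (symdiff A B) \<longleftrightarrow> finite B"
  by (metis finite_Diff finite_UnI symdiff_def symdiff_simps(4))

lemma symdiff_subset: "A \<subseteq> N \<Longrightarrow> symdiff A B \<subseteq> N \<longleftrightarrow> B \<subseteq> N"
  by (auto simp: symdiff_def)

lemma reorder_sign_empty [simp]: "reorder_sign {} B = 1" "reorder_sign A {} = 1"
  by (auto simp: reorder_sign_def)

lemma prod_symdiff:
  fixes f :: "nat \<Rightarrow> 'k::comm_ring_1"
  assumes "finite A" "finite B" "\<And>x. f x * f x = 1"
  shows "prod f (symdiff A B) = prod f A * prod f B"
proof -
  have A: "prod f A = prod f (A - B) * prod f (A \<inter> B)"
    using assms(1) prod.Int_Diff[of A f B] by (simp add: mult.commute)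
  have B: "prod f B = prod f (B - A) * prod f (A \<inter> B)"
    using assms(2) prod.Int_Diff[of B f A] by (simp add: mult.commute Int_commute)
  have "prod f (A \<inter> B) * prod f (A \<inter> B) = 1"
    by (simp flip: prod.distrib add: assms(3))
  then have "prod f A * prod f B = prod f (A - B) * prod f (B - A)"
    unfolding A B by (simp add: mult.assoc mult.left_commute[of _ "prod f (B - A)"])
  moreover have "prod f (symdiff A B) = prod f (A - B) * prod f (B - A)"
    unfolding symdiff_def using assms(1,2) by (intro prod.union_disjoint) auto
  ultimately show ?thesis by simp
qed

lemma reorder_sign_symdiff_left:
  assumes "finite A" "finite B"
  shows "reorder_sign (symdiff A B) C = reorder_sign A C * (reorder_sign B C :: 'k::comm_ring_1)"
  unfolding reorder_sign_def using assms
  by (intro prod_symdiff) (auto simp flip: prod.distrib intro!: prod.neutral)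

lemma reorder_sign_symdiff_right:
  assumes "finite B" "finite C"
  shows "reorder_sign A (symdiff B C) = reorder_sign A B * (reorder_sign A C :: 'k::comm_ring_1)"
proof -
  have "reorder_sign A (symdiff B C)
      = (\<Prod>a\<in>A. (\<Prod>b\<in>B. if b \<le> a then -1 else 1) * (\<Prod>b\<in>C. if b \<le> a then -1 else (1::'k)))"
    unfolding reorder_sign_def using assms
    by (intro prod.cong refl prod_symdiff) auto
  then show ?thesis by (simp add: reorder_sign_def prod.distrib)
qed

lemma norm_reorder_sign [simp]: "norm (reorder_sign A B :: 'k::real_normed_field) = 1"
  unfolding reorder_sign_def by (simp flip: prod_norm add: if_distrib cong: if_cong)

typedef (overloaded) ('k::zero) clifford =
  "{f :: nat set \<Rightarrow> 'k. finite {A. f A \<noteq> 0} \<and> (\<forall>A. f A \<noteq> 0 \<longrightarrow> finite A)}"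
  morphisms blade_coeff Abs_clifford
  by (rule exI[of _ "\<lambda>_. 0"]) simp

setup_lifting type_definition_clifford

lemma finite_support: "finite {A. blade_coeff a A \<noteq> 0}"
  using blade_coeff[of a] by simp

lemma coeff_infinite: "infinite A \<Longrightarrow> blade_coeff a A = 0"
  using blade_coeff[of a] by auto

lemma clifford_eqI: "(\<And>A. blade_coeff a A = blade_coeff b A) \<Longrightarrow> a = b"
  by (rule blade_coeff_inject[THEN iffD1], rule ext)

lemma common_support:
  obtains N where "finite N" "\<forall>A. blade_coeff a A \<noteq> 0 \<longrightarrow> A \<subseteq> N"
proof
  show "finite (\<Union> {A. blade_coeff a A \<noteq> 0})"
    using coeff_infinite by (intro finite_Union finite_support) blast
qed auto

lemma sum_support:
  assumes "finite U" "\<And>A. blade_coeff a A \<noteq> 0 \<Longrightarrow> A \<in> U" "\<And>A. blade_coeff a A = 0 \<Longrightarrow> g A = 0"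
  shows "(\<Sum>A | blade_coeff a A \<noteq> 0. g A) = (\<Sum>A\<in>U. g A)"
  using assms(1,2,3) by (intro sum.mono_neutral_left) blast+

instantiation clifford :: (real_normed_field) ring_1
begin

lift_definition zero_clifford :: "'a clifford" is "\<lambda>_. 0" by simp

lift_definition one_clifford :: "'a clifford" is "\<lambda>A. if A = {} then 1 else 0" by simp

lift_definition uminus_clifford :: "'a clifford \<Rightarrow> 'a clifford" is "\<lambda>f A. - f A" by simp

lift_definition plus_clifford :: "'a clifford \<Rightarrow> 'a clifford \<Rightarrow> 'a clifford"
  is "\<lambda>f g A. f A + g A"
proof safe
  fix f g :: "nat set \<Rightarrow> 'a"
  assume "finite {A. f A \<noteq> 0}" "finite {A. g A \<noteq> 0}"
  then show "finite {A. f A + g A \<noteq> 0}"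
    by (rule_tac finite_subset[of _ "{A. f A \<noteq> 0} \<union> {A. g A \<noteq> 0}"]) auto
qed (metis add_0)

lift_definition minus_clifford :: "'a clifford \<Rightarrow> 'a clifford \<Rightarrow> 'a clifford"
  is "\<lambda>f g A. f A - g A"
proof safe
  fix f g :: "nat set \<Rightarrow> 'a"
  assume "finite {A. f A \<noteq> 0}" "finite {A. g A \<noteq> 0}"
  then show "finite {A. f A - g A \<noteq> 0}"
    by (rule_tac finite_subset[of _ "{A. f A \<noteq> 0} \<union> {A. g A \<noteq> 0}"]) auto
qed (metis diff_zero)

lift_definition times_clifford :: "'a clifford \<Rightarrow> 'a clifford \<Rightarrow> 'a clifford"
  is "\<lambda>f g C. \<Sum>A | f A \<noteq> 0. reorder_sign A (symdiff A C) * f A * g (symdiff A C)"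
proof -
  fix f g :: "nat set \<Rightarrow> 'a"
  let ?h = "\<lambda>C. \<Sum>A | f A \<noteq> 0. reorder_sign A (symdiff A C) * f A * g (symdiff A C)"
  assume "finite {A. f A \<noteq> 0} \<and> (\<forall>A. f A \<noteq> 0 \<longrightarrow> finite A)"
    and "finite {A. g A \<noteq> 0} \<and> (\<forall>A. g A \<noteq> 0 \<longrightarrow> finite A)"
  then have f: "finite {A. f A \<noteq> 0}" "\<And>A. f A \<noteq> 0 \<Longrightarrow> finite A"
    and g: "finite {A. g A \<noteq> 0}" "\<And>A. g A \<noteq> 0 \<Longrightarrow> finite A" by blast+
  have ex: "\<exists>A B. f A \<noteq> 0 \<and> g B \<noteq> 0 \<and> C = symdiff A B" if "?h C \<noteq> 0" for C
  proof -
    from that obtain A where "A \<in> {A. f A \<noteq> 0}"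
      and "reorder_sign A (symdiff A C) * f A * g (symdiff A C) \<noteq> 0"
      by (rule sum.not_neutral_contains_not_neutral)
    then have "f A \<noteq> 0" "g (symdiff A C) \<noteq> 0" by auto
    moreover have "C = symdiff A (symdiff A C)" by simp
    ultimately show ?thesis by blast
  qed
  have "{C. ?h C \<noteq> 0} \<subseteq> (\<lambda>(A, B). symdiff A B) ` ({A. f A \<noteq> 0} \<times> {B. g B \<noteq> 0})"
    using ex by force
  then have "finite {C. ?h C \<noteq> 0}"
    by (rule finite_subset) (use f g in auto)
  moreover have "finite C" if "?h C \<noteq> 0" for C
    using ex[OF that] f(2) g(2) by (auto simp: finite_symdiff_iff)
  ultimately show "finite {C. ?h C \<noteq> 0} \<and> (\<forall>C. ?h C \<noteq> 0 \<longrightarrow> finite C)"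
    by blast
qed

lemma coeff_times:
  assumes "finite N" "\<forall>A. blade_coeff (a :: 'a clifford) A \<noteq> 0 \<longrightarrow> A \<subseteq> N"
  shows "blade_coeff (a * b) C =
    (\<Sum>A\<in>Pow N. reorder_sign A (symdiff A C) * blade_coeff a A * blade_coeff b (symdiff A C))"
  unfolding times_clifford.rep_eq using assms by (intro sum_support) auto

lemma coeff_times_nonzero:
  assumes "finite N" "\<forall>A. blade_coeff (a :: 'a clifford) A \<noteq> 0 \<longrightarrow> A \<subseteq> N"
    "\<forall>A. blade_coeff b A \<noteq> 0 \<longrightarrow> A \<subseteq> N"
  shows "\<forall>C. blade_coeff (a * b) C \<noteq> 0 \<longrightarrow> C \<subseteq> N"
proof (intro allI impI, rule ccontr)
  fix C assume "blade_coeff (a * b) C \<noteq> 0" "\<not> C \<subseteq> N"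
  moreover have "blade_coeff b (symdiff A C) = 0" if "A \<subseteq> N" for A
    using assms(3) symdiff_subset[OF that] \<open>\<not> C \<subseteq> N\<close> by blast
  ultimately show False
    by (simp add: coeff_times[OF assms(1,2)])
qed

lemma sum_Pow_symdiff:
  assumes "A \<subseteq> N"
  shows "(\<Sum>E\<in>Pow N. g E) = (\<Sum>B\<in>Pow N. g (symdiff A B))"
  by (rule sum.reindex_bij_witness[of _ "symdiff A" "symdiff A"])
     (use assms symdiff_subset in auto)

instance
proof
  fix a b c :: "'a clifford"
  obtain Na where Na: "finite Na" "\<forall>A. blade_coeff a A \<noteq> 0 \<longrightarrow> A \<subseteq> Na" using common_support by blast
  obtain Nb where Nb: "finite Nb" "\<forall>A. blade_coeff b A \<noteq> 0 \<longrightarrow> A \<subseteq> Nb" using common_support by blast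
  define N where "N = Na \<union> Nb"
  have N: "finite N" "\<forall>A. blade_coeff a A \<noteq> 0 \<longrightarrow> A \<subseteq> N" "\<forall>A. blade_coeff b A \<noteq> 0 \<longrightarrow> A \<subseteq> N"
    using Na Nb by (auto simp: N_def)
  have fin: "finite A" if "A \<subseteq> N" for A using that N(1) finite_subset by blast
  show "a * b * c = a * (b * c)"
  proof (rule clifford_eqI)
    fix D
    let ?s = "reorder_sign :: nat set \<Rightarrow> nat set \<Rightarrow> 'a"
    have summand: "?s (symdiff A B) (symdiff (symdiff A B) D)
          * (?s A (symdiff A (symdiff A B)) * blade_coeff a A * blade_coeff b (symdiff A (symdiff A B)))
          * blade_coeff c (symdiff (symdiff A B) D)
        = ?s A (symdiff A D) * blade_coeff a A *
          (?s B (symdiff B (symdiff A D)) * blade_coeff b B * blade_coeff c (symdiff B (symdiff A D)))"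
      if "A \<subseteq> N" "B \<subseteq> N" for A B
    proof (cases "finite D")
      case True
      define G where "G = symdiff (symdiff A B) D"
      have G: "symdiff B (symdiff A D) = G" "symdiff A D = symdiff B G"
        by (auto simp: G_def symdiff_def)
      have "finite G"
        unfolding G_def using True that by (auto simp: symdiff_def dest: fin)
      then show ?thesis
        unfolding G_def[symmetric] using that fin
        by (simp add: G reorder_sign_symdiff_left reorder_sign_symdiff_right)
    next
      case False
      then have "infinite (symdiff B (symdiff A D))" "infinite (symdiff (symdiff A B) D)"
        using that by (auto simp: finite_symdiff_iff fin symdiff_assoc)
      then show ?thesis by (simp add: coeff_infinite)
    qed
    have "blade_coeff (a * b * c) D =
        (\<Sum>E\<in>Pow N. ?s E (symdiff E D)
          * (\<Sum>A\<in>Pow N. ?s A (symdiff A E) * blade_coeff a A * blade_coeff b (symdiff A E))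
          * blade_coeff c (symdiff E D))"
      by (simp only: coeff_times[OF N(1) coeff_times_nonzero[OF N]] coeff_times[OF N(1,2)])
    also have "\<dots> = (\<Sum>A\<in>Pow N. \<Sum>E\<in>Pow N. ?s E (symdiff E D)
          * (?s A (symdiff A E) * blade_coeff a A * blade_coeff b (symdiff A E))
          * blade_coeff c (symdiff E D))"
      by (subst sum.swap) (simp only: sum_distrib_left sum_distrib_right)
    also have "\<dots> = (\<Sum>A\<in>Pow N. \<Sum>B\<in>Pow N. ?s A (symdiff A D) * blade_coeff a A *
          (?s B (symdiff B (symdiff A D)) * blade_coeff b B * blade_coeff c (symdiff B (symdiff A D))))"
    proof (rule sum.cong[OF refl], goal_cases)
      case (1 A)
      then have "A \<subseteq> N" by simp
      show ?case
        by (subst sum_Pow_symdiff[OF \<open>A \<subseteq> N\<close>], rule sum.cong[OF refl], rule summand)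
          (use \<open>A \<subseteq> N\<close> in auto)
    qed
    also have "\<dots> = blade_coeff (a * (b * c)) D"
      by (simp only: coeff_times[OF N(1,2)] coeff_times[OF N(1,3)] sum_distrib_left)
    finally show "blade_coeff (a * b * c) D = blade_coeff (a * (b * c)) D" .
  qed
  show "(a + b) * c = a * c + b * c"
  proof (rule clifford_eqI)
    fix D
    have ab: "\<forall>A. blade_coeff (a + b) A \<noteq> 0 \<longrightarrow> A \<subseteq> N"
      using N(2,3) by (metis add_0 plus_clifford.rep_eq)
    show "blade_coeff ((a + b) * c) D = blade_coeff (a * c + b * c) D"
      by (simp add: plus_clifford.rep_eq coeff_times[OF N(1) ab] coeff_times[OF N(1,2)]
        coeff_times[OF N(1,3)] distrib_left distrib_right sum.distrib)
  qed
  show "a * (b + c) = a * b + a * c"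
    by (rule clifford_eqI)
      (simp add: plus_clifford.rep_eq times_clifford.rep_eq distrib_left sum.distrib)
  show "1 * a = a"
    by (rule clifford_eqI) (simp add: times_clifford.rep_eq one_clifford.rep_eq)
  show "a * 1 = a"
  proof (rule clifford_eqI)
    fix D
    have "blade_coeff (a * 1) D =
      (\<Sum>A | blade_coeff a A \<noteq> 0. if A = D then blade_coeff a D else 0)"
      unfolding times_clifford.rep_eq one_clifford.rep_eq
      by (intro sum.cong) (auto simp: symdiff_eq_iff)
    then show "blade_coeff (a * 1) D = blade_coeff a D"
      by (simp add: finite_support)
  qed
  show "(0 :: 'a clifford) \<noteq> 1"
  proof
    assume "(0 :: 'a clifford) = 1"
    then have "blade_coeff (0 :: 'a clifford) {} = blade_coeff 1 {}" by simp
    then show False by (simp add: zero_clifford.rep_eq one_clifford.rep_eq)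
  qed
qed (rule clifford_eqI,
     simp add: plus_clifford.rep_eq minus_clifford.rep_eq uminus_clifford.rep_eq
       zero_clifford.rep_eq)+

end

instantiation clifford :: (real_normed_field) real_vector
begin

lift_definition scaleR_clifford :: "real \<Rightarrow> 'a clifford \<Rightarrow> 'a clifford" is "\<lambda>c f A. c *\<^sub>R f A"
  by auto

instance
  by standard
    (rule clifford_eqI,
     simp add: plus_clifford.rep_eq scaleR_clifford.rep_eq algebra_simps)+

end

text \<open>
  The norm is the sum of the absolute values of the coefficients; on each of the
  finite-dimensional subalgebras it induces the usual topology.
\<close>

instantiation clifford :: (real_normed_field) real_normed_algebra_1
begin

definition norm_clifford :: "'a clifford \<Rightarrow> real" where
  "norm_clifford a = (\<Sum>A | blade_coeff a A \<noteq> 0. norm (blade_coeff a A))"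

definition dist_clifford :: "'a clifford \<Rightarrow> 'a clifford \<Rightarrow> real" where
  "dist_clifford a b = norm (a - b)"

definition sgn_clifford :: "'a clifford \<Rightarrow> 'a clifford" where
  "sgn_clifford a = a /\<^sub>R norm a"

definition uniformity_clifford :: "('a clifford \<times> 'a clifford) filter" where
  "uniformity_clifford = (INF e\<in>{0<..}. principal {(x, y). dist x y < e})"

definition open_clifford :: "'a clifford set \<Rightarrow> bool" where
  "open_clifford U \<longleftrightarrow> (\<forall>x\<in>U. eventually (\<lambda>(x', y). x' = x \<longrightarrow> y \<in> U) uniformity)"

lemma norm_clifford_Pow:
  assumes "finite N" "\<forall>A. blade_coeff (a :: 'a clifford) A \<noteq> 0 \<longrightarrow> A \<subseteq> N"
  shows "norm a = (\<Sum>A\<in>Pow N. norm (blade_coeff a A))"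
  unfolding norm_clifford_def using assms by (intro sum_support) auto

instance
proof
  fix a b :: "'a clifford" and r :: real
  obtain Na where Na: "finite Na" "\<forall>A. blade_coeff a A \<noteq> 0 \<longrightarrow> A \<subseteq> Na" using common_support by blast
  obtain Nb where Nb: "finite Nb" "\<forall>A. blade_coeff b A \<noteq> 0 \<longrightarrow> A \<subseteq> Nb" using common_support by blast
  define N where "N = Na \<union> Nb"
  have N: "finite N" "\<forall>A. blade_coeff a A \<noteq> 0 \<longrightarrow> A \<subseteq> N" "\<forall>A. blade_coeff b A \<noteq> 0 \<longrightarrow> A \<subseteq> N"
    using Na Nb by (auto simp: N_def)
  show "dist a b = norm (a - b)" by (rule dist_clifford_def)
  show "sgn a = a /\<^sub>R norm a" by (rule sgn_clifford_def)
  show "uniformity = (INF e\<in>{0<..}. principal {(x :: 'a clifford, y). dist x y < e})"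
    by (rule uniformity_clifford_def)
  show "open U \<longleftrightarrow> (\<forall>x\<in>U. eventually (\<lambda>(x', y). x' = x \<longrightarrow> y \<in> U) uniformity)"
    for U :: "'a clifford set"
    by (rule open_clifford_def)
  have sc: "\<forall>A. blade_coeff (r *\<^sub>R a) A \<noteq> 0 \<longrightarrow> A \<subseteq> N"
    using N(2) by (simp add: scaleR_clifford.rep_eq)
  show "r *\<^sub>R a * b = r *\<^sub>R (a * b)"
    by (rule clifford_eqI)
      (simp add: scaleR_clifford.rep_eq coeff_times[OF N(1) sc] coeff_times[OF N(1,2)]
        scaleR_sum_right)
  show "a * r *\<^sub>R b = r *\<^sub>R (a * b)"
    by (rule clifford_eqI)
      (simp add: scaleR_clifford.rep_eq coeff_times[OF N(1,2)] scaleR_sum_right)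
  show "norm a = 0 \<longleftrightarrow> a = 0"
  proof
    assume "norm a = 0"
    then have "\<forall>A\<in>{A. blade_coeff a A \<noteq> 0}. norm (blade_coeff a A) = 0"
      unfolding norm_clifford_def
      by (subst (asm) sum_nonneg_eq_0_iff[OF finite_support norm_ge_zero])
    then have "blade_coeff a A = blade_coeff 0 A" for A
      unfolding zero_clifford.rep_eq by force
    then show "a = 0" by (rule clifford_eqI)
  qed (simp add: norm_clifford_def zero_clifford.rep_eq)
  have ab: "\<forall>A. blade_coeff (a + b) A \<noteq> 0 \<longrightarrow> A \<subseteq> N"
    using N(2,3) by (metis add_0 plus_clifford.rep_eq)
  show "norm (a + b) \<le> norm a + norm b"
    unfolding norm_clifford_Pow[OF N(1) ab] norm_clifford_Pow[OF N(1,2)]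
      norm_clifford_Pow[OF N(1,3)] plus_clifford.rep_eq sum.distrib[symmetric]
    by (intro sum_mono norm_triangle_ineq)
  show "norm (r *\<^sub>R a) = \<bar>r\<bar> * norm a"
    by (simp add: norm_clifford_Pow[OF N(1) sc] norm_clifford_Pow[OF N(1,2)]
      scaleR_clifford.rep_eq sum_distrib_left)
  show "norm (a * b) \<le> norm a * norm b"
  proof -
    have "norm (a * b) = (\<Sum>C\<in>Pow N. norm (\<Sum>A\<in>Pow N.
        reorder_sign A (symdiff A C) * blade_coeff a A * blade_coeff b (symdiff A C)))"
      by (simp only: norm_clifford_Pow[OF N(1) coeff_times_nonzero[OF N]] coeff_times[OF N(1,2)])
    also have "\<dots> \<le> (\<Sum>C\<in>Pow N. \<Sum>A\<in>Pow N. norm (blade_coeff a A) * norm (blade_coeff b (symdiff A C)))"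
      by (intro sum_mono order.trans[OF norm_sum]) (simp add: norm_mult)
    also have "\<dots> = (\<Sum>A\<in>Pow N. \<Sum>C\<in>Pow N. norm (blade_coeff a A) * norm (blade_coeff b (symdiff A C)))"
      by (rule sum.swap)
    also have "\<dots> = (\<Sum>A\<in>Pow N. \<Sum>C\<in>Pow N. norm (blade_coeff a A) * norm (blade_coeff b C))"
    proof (rule sum.cong[OF refl], goal_cases)
      case (1 A)
      then show ?case
        using sum_Pow_symdiff[of A N "\<lambda>C. norm (blade_coeff a A) * norm (blade_coeff b C)"] by simp
    qed
    also have "\<dots> = norm a * norm b"
      by (simp add: norm_clifford_Pow[OF N(1,2)] norm_clifford_Pow[OF N(1,3)] sum_product)
    finally show ?thesis .
  qed
  show "norm (1 :: 'a clifford) = 1"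
    by (simp add: norm_clifford_def one_clifford.rep_eq)
qed

end

lift_definition e :: "nat \<Rightarrow> 'k::real_normed_field clifford" is "\<lambda>i A. if A = {i} then 1 else 0"
  by simp

lift_definition scalar :: "'k::real_normed_field \<Rightarrow> 'k clifford" is "\<lambda>z A. if A = {} then z else 0"
  by simp

lift_definition grade_part :: "nat \<Rightarrow> 'k::real_normed_field clifford \<Rightarrow> 'k clifford"
  is "\<lambda>s f A. if card A = s then f A else 0"
  by (auto elim: rev_finite_subset)

lemma coeff_e_times:
  "blade_coeff (e i * a) C = reorder_sign {i} (symdiff {i} C) * blade_coeff (a :: 'k::real_normed_field clifford) (symdiff {i} C)"
  by (simp add: times_clifford.rep_eq e.rep_eq)

lemma coeff_e: "blade_coeff (e i :: 'k::real_normed_field clifford) A = (if A = {i} then 1 else 0)"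
  by (simp add: e.rep_eq)

lemma e_anticommute:
  "e i * e j + e j * e i = (if i = j then -2 else 0 :: 'k::real_normed_field clifford)"
proof (rule clifford_eqI)
  fix C
  have two: "blade_coeff (-2 :: 'k clifford) C = (if C = {} then -2 else 0)"
    unfolding one_add_one[symmetric] uminus_clifford.rep_eq plus_clifford.rep_eq one_clifford.rep_eq
    by simp
  have swap: "symdiff {j} {i} = symdiff {i} {j}" by (rule symdiff_commute)
  have iff: "symdiff {i} C = {j} \<longleftrightarrow> C = symdiff {i} {j}" "symdiff {j} C = {i} \<longleftrightarrow> C = symdiff {i} {j}"
    using symdiff_eq_iff[of "{i}" C "{j}"] symdiff_eq_iff[of "{j}" C "{i}"] swap by auto
  have "blade_coeff (e i * e j + e j * e i) C
      = (if C = symdiff {i} {j} then reorder_sign {i} {j} + reorder_sign {j} {i} else (0 :: 'k))"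
    using symdiff_simps(4)[of "{j}" "{i}"]
    by (auto simp: plus_clifford.rep_eq coeff_e_times coeff_e iff swap)
  also have "\<dots> = blade_coeff (if i = j then -2 else 0) C"
  proof (cases "i = j")
    case True
    show ?thesis unfolding True by (subst if_P, rule refl, subst two) (simp add: reorder_sign_def)
  next
    case False
    then have "reorder_sign {i} {j} + reorder_sign {j} {i} = (0 :: 'k)"
      by (cases i j rule: linorder_cases) (simp_all add: reorder_sign_def)
    with False show ?thesis by (simp add: zero_clifford.rep_eq)
  qed
  finally show "blade_coeff (e i * e j + e j * e i) C = blade_coeff (if i = j then -2 else 0 :: 'k clifford) C" .
qed

lemma prod_list_e:
  assumes "sorted_wrt (<) is"
  shows "blade_coeff (prod_list (map e is)) A = (if A = set is then 1 else (0 :: 'k::real_normed_field))"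
  using assms
proof (induction "is" arbitrary: A)
  case Nil
  then show ?case by (simp add: one_clifford.rep_eq)
next
  case (Cons i js)
  have *: "symdiff {i} A = set js \<longleftrightarrow> A = insert i (set js)"
    using Cons.prems by (subst symdiff_eq_iff) (auto simp: symdiff_def)
  have "reorder_sign {i} (set js) = (1 :: 'k)"
    unfolding reorder_sign_def using Cons.prems by (auto intro!: prod.neutral)
  moreover have "blade_coeff (prod_list (map e js)) B = (if B = set js then 1 else (0 :: 'k))" for B
    using Cons by simp
  ultimately have "blade_coeff (prod_list (map e (i # js))) A
      = (if symdiff {i} A = set js then 1 else (0 :: 'k))"
    by (auto simp: coeff_e_times)
  then show ?case by (simp add: *)
qed

text \<open>
  The two products with a 1-vector \<open>u\<close>, given by a formula on \<open>s\<close>-vectors \<open>v\<close> and extended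
  linearly in \<open>v\<close>; \<open>grade_part s v\<close> is the \<open>s\<close>-vector part of \<open>v\<close>.
\<close>

definition wedge :: "'k::real_normed_field clifford \<Rightarrow> 'k clifford \<Rightarrow> 'k clifford" where
  "wedge u v = (\<Sum>s | grade_part s v \<noteq> 0.
     (1/2) *\<^sub>R (u * grade_part s v + (-1) ^ s * grade_part s v * u))"

definition bullet :: "'k::real_normed_field clifford \<Rightarrow> 'k clifford \<Rightarrow> 'k clifford" where
  "bullet u v = (\<Sum>s | grade_part s v \<noteq> 0.
     (1/2) *\<^sub>R (u * grade_part s v - (-1) ^ s * grade_part s v * u))"

lemma grade_part_homogeneous:
  assumes "grade_part s v = v"
  shows "grade_part s' v = (if s' = s then v else 0)"
proof (rule clifford_eqI)
  fix A
  have "blade_coeff v A = (if card A = s then blade_coeff v A else 0)"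
    using grade_part.rep_eq[of s v] assms by (metis (no_types, lifting))
  then show "blade_coeff (grade_part s' v) A = blade_coeff (if s' = s then v else 0) A"
    by (auto simp: grade_part.rep_eq zero_clifford.rep_eq split: if_splits)
qed

lemma wedge_bullet_homogeneous:
  assumes "grade_part s v = v"
  shows "wedge u v = (1/2) *\<^sub>R (u * v + (-1) ^ s * v * u)"
    and "bullet u v = (1/2) *\<^sub>R (u * v - (-1) ^ s * v * u)"
proof -
  have "{s'. grade_part s' v \<noteq> 0} = (if v = 0 then {} else {s})"
    by (subst grade_part_homogeneous[OF assms]) auto
  then show "wedge u v = (1/2) *\<^sub>R (u * v + (-1) ^ s * v * u)"
    and "bullet u v = (1/2) *\<^sub>R (u * v - (-1) ^ s * v * u)"
    by (auto simp: wedge_def bullet_def assms)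
qed


section \<open>Functions on Euclidean space and partial derivatives\<close>

text \<open>
  A point is a sequence of which the coordinates \<open>x 1, x 2, \<dots>\<close> are used; a function on
  \<open>\<real>\<^sup>r\<close> is a function of such sequences that depends on \<open>x 1, \<dots>, x r\<close> only, so that
  functions on \<open>\<real>\<^bsup>r-1\<^esup>\<close> are also functions on \<open>\<real>\<^sup>r\<close>.
\<close>

type_synonym 'k cfun = "(nat \<Rightarrow> real) \<Rightarrow> 'k clifford"

definition partial :: "nat \<Rightarrow> 'k::real_normed_field cfun \<Rightarrow> 'k cfun" where
  "partial i g = (\<lambda>x. vector_derivative (\<lambda>t. g (x(i := t))) (at (x i)))"


section \<open>Index sets\<close>

text \<open>
  The grades \<open>s, t\<close> are integers, so that \<open>s - 1\<close> is not truncated.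
\<close>

definition N_index :: "int \<Rightarrow> nat \<Rightarrow> nat \<Rightarrow> (int \<times> nat) set" where
  "N_index s r k =
     (if s \<in> {0, int r} \<and> k \<ge> 1 then {}
      else {(t, j). t \<in> {0..int r - 1} \<and> j \<in> {0..k} \<and> t \<in> {s - 1, s} \<and>
                    (t \<in> {0, int r - 1} \<longrightarrow> j = 0)})"

text \<open>
  Sequences \<open>\<nu> = (s\<^bsub>m-1\<^esub>, \<dots>, s\<^sub>3, t\<^sub>2)\<close> and \<open>\<mu> = (k\<^bsub>m-1\<^esub>, \<dots>, k\<^sub>3, k\<^sub>2)\<close> are functions of the
  subscript, of which only the values on \<open>{2..m-1}\<close> are used: \<open>\<nu> 2\<close> is \<open>t\<^sub>2\<close>, \<open>\<nu> r\<close> is \<open>s\<^sub>r\<close> for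
  \<open>3 \<le> r < m\<close>, and \<open>\<mu> r\<close> is \<open>k\<^sub>r\<close>. The next two functions add the conventions \<open>s\<^sub>m = s\<close>,
  \<open>s\<^sub>2 = \<bar>t\<^sub>2\<bar>\<close> and \<open>k\<^sub>m = k\<close>.
\<close>

definition s_at :: "nat \<Rightarrow> int \<Rightarrow> (nat \<Rightarrow> int) \<Rightarrow> nat \<Rightarrow> int" where
  "s_at m s \<nu> = \<nu>(2 := \<bar>\<nu> 2\<bar>, m := s)"

definition k_at :: "nat \<Rightarrow> nat \<Rightarrow> (nat \<Rightarrow> nat) \<Rightarrow> nat \<Rightarrow> nat" where
  "k_at m k \<mu> = \<mu>(m := k)"

definition I_index :: "nat \<Rightarrow> int \<Rightarrow> nat \<Rightarrow> ((nat \<Rightarrow> int) \<times> (nat \<Rightarrow> nat)) set" where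
  "I_index m s k = {(\<nu>, \<mu>).
     (\<nu> 2, \<mu> 2) \<in> {(0, 0), (2, 0)} \<union> {1, -1} \<times> UNIV \<and>
     (\<forall>r\<in>{3..m}. (s_at m s \<nu> (r - 1), k_at m k \<mu> (r - 1)) \<in> N_index (s_at m s \<nu> r) r (k_at m k \<mu> r))}"


section \<open>Embedding factors\<close>

definition gegenbauer :: "nat \<Rightarrow> real \<Rightarrow> real \<Rightarrow> real" where
  "gegenbauer n a z = (\<Sum>i = 0..n div 2.
     (-1) ^ i * pochhammer a (n - i) / (fact i * fact (n - 2 * i)) * (2 * z) ^ (n - 2 * i))"

definition radius :: "nat \<Rightarrow> (nat \<Rightarrow> real) \<Rightarrow> real" where
  "radius r x = sqrt (\<Sum>i = 1..r. (x i)\<^sup>2)"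

definition vec1 :: "nat \<Rightarrow> 'k::real_normed_field cfun" where
  "vec1 r x = (\<Sum>i = 1..r. x i *\<^sub>R e i)"

text \<open>
  At the origin the division by zero is harmless: there the polynomial \<open>F r j n\<close> is \<open>1\<close> for
  \<open>n = 0\<close> and \<open>0\<close> for \<open>n > 0\<close>, as is the value of the formula.
\<close>

definition F :: "nat \<Rightarrow> nat \<Rightarrow> int \<Rightarrow> (nat \<Rightarrow> real) \<Rightarrow> real" where
  "F r j n x = (if n < 0 then 0 else
     pochhammer (real j + 1) (nat n) / pochhammer (real r - 2 + 2 * real j) (nat n)
     * radius r x ^ nat n * gegenbauer (nat n) (real r / 2 + real j - 1) (x r / radius r x))"

definition X :: "nat \<Rightarrow> nat \<Rightarrow> int \<Rightarrow> 'k::real_normed_field cfun" where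
  "X r j n x = (if n < 0 then 0 else
     of_real (F r j n x)
     + ((real j + 1) / (real r + 2 * real j - 1) * F r (j + 1) (n - 1) x) *\<^sub>R (vec1 (r - 1) x * e r))"

definition \<alpha>_coeff :: "nat \<Rightarrow> int \<Rightarrow> nat \<Rightarrow> real" where
  "\<alpha>_coeff r t j =
     (if t \<in> {0, int r - 1} then 0 else - (real j + 1) / (real r + 2 * real j - 1))"

definition \<beta>_coeff :: "nat \<Rightarrow> int \<Rightarrow> nat \<Rightarrow> real" where
  "\<beta>_coeff r t j = - (real j + real r - 1 - of_int t) / (real j + of_int t)"

text \<open>
  \<open>embed s t r k j\<close> is the operator \<open>X\<^bsup>s,t,r\<^esup>\<^bsub>k,j\<^esub>\<close>. The exponents of \<open>e r\<close> are nonnegative for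
  \<open>t \<in> {s - 1, s}\<close>, and \<open>\<beta>\<close> is nonzero unless \<open>\<alpha> = 0\<close>.
\<close>

definition embed :: "int \<Rightarrow> int \<Rightarrow> nat \<Rightarrow> nat \<Rightarrow> nat \<Rightarrow> 'k::real_normed_field cfun \<Rightarrow> 'k cfun" where
  "embed s t r k j g = (\<lambda>x.
     (let \<alpha> = \<alpha>_coeff r t j; \<beta> = \<beta>_coeff r t j;
          u = vec1 (r - 1) x; w = e r ^ nat (s - t + 1) * g x
      in X r j (int k - int j) x * (e r ^ nat (s - t) * g x)
         + \<alpha> *\<^sub>R (X r (j + 1) (int k - 1 - int j) x
             * ((\<beta> powi (t - s)) *\<^sub>R wedge u w + (\<beta> powi (t - s + 1)) *\<^sub>R bullet u w))))"


section \<open>The planar case\<close>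

definition e2_real :: "int \<Rightarrow> real clifford" where
  "e2_real t = (if t = 0 then 1 else if t = 2 then e 2 * e 1 else if t = 1 then e 1 else e 2)"

definition f2_real :: "int \<Rightarrow> nat \<Rightarrow> real cfun" where
  "f2_real t l x =
     (if t \<in> {0, 2} then e2_real t
      else (of_real (x 1) - e 1 * e 2 * of_real (x 2)) ^ l * e2_real t)"

definition d2_real :: "int \<Rightarrow> real cfun \<Rightarrow> real cfun" where
  "d2_real t g =
     (if t \<in> {0, 2} then g
      else (\<lambda>x. (1/2) *\<^sub>R (partial 1 g x + e 1 * e 2 * partial 2 g x)))"

text \<open>
  For \<open>t = \<plusminus>1\<close> the factor \<open>of_int t\<close> is the sign \<open>\<plusminus>\<close>.
\<close>

definition e2_complex :: "int \<Rightarrow> complex clifford" where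
  "e2_complex t =
     (if t = 0 then 1 else if t = 2 then e 2 * e 1 else e 1 - of_int t * scalar \<i> * e 2)"

definition f2_complex :: "int \<Rightarrow> nat \<Rightarrow> complex cfun" where
  "f2_complex t l x =
     (if t \<in> {0, 2} then e2_complex t
      else (of_real (x 1) - of_int t * scalar \<i> * of_real (x 2)) ^ l * e2_complex t)"

definition d2_complex :: "int \<Rightarrow> complex cfun \<Rightarrow> complex cfun" where
  "d2_complex t g =
     (if t \<in> {0, 2} then g
      else (\<lambda>x. (1/2) *\<^sub>R (partial 1 g x + of_int t * scalar \<i> * partial 2 g x)))"


section \<open>The basis polynomials\<close>

text \<open>
  \<open>fold\<close> applies the factor for \<open>r = 3\<close> first and that for \<open>r = m\<close> last (outermost);
  \<open>foldr\<close> applies the factor for \<open>r = m\<close> first.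
\<close>

definition basis_poly ::
  "(int \<Rightarrow> nat \<Rightarrow> 'k::real_normed_field cfun) \<Rightarrow> nat \<Rightarrow> int \<Rightarrow> nat \<Rightarrow> (nat \<Rightarrow> int) \<Rightarrow> (nat \<Rightarrow> nat) \<Rightarrow> 'k cfun"
where
  "basis_poly f2 m s k \<nu> \<mu> =
     fold (\<lambda>r. embed (s_at m s \<nu> r) (s_at m s \<nu> (r - 1)) r (k_at m k \<mu> r) (k_at m k \<mu> (r - 1)))
       [3..<m + 1] (f2 (\<nu> 2) (\<mu> 2))"

definition basis_vector ::
  "(int \<Rightarrow> 'k::real_normed_field clifford) \<Rightarrow> nat \<Rightarrow> int \<Rightarrow> (nat \<Rightarrow> int) \<Rightarrow> 'k clifford"
where
  "basis_vector e2 m s \<nu> =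
     fold (\<lambda>r v. e r ^ nat (s_at m s \<nu> r - s_at m s \<nu> (r - 1)) * v) [3..<m + 1] (e2 (\<nu> 2))"

definition iterated_deriv ::
  "(int \<Rightarrow> 'k::real_normed_field cfun \<Rightarrow> 'k cfun) \<Rightarrow> nat \<Rightarrow> nat \<Rightarrow> (nat \<Rightarrow> int) \<Rightarrow> (nat \<Rightarrow> nat) \<Rightarrow> 'k cfun \<Rightarrow> 'k cfun"
where
  "iterated_deriv d2 m k \<nu> \<mu> g =
     (d2 (\<nu> 2) ^^ \<mu> 2)
       (foldr (\<lambda>r. partial r ^^ (k_at m k \<mu> r - k_at m k \<mu> (r - 1))) [3..<m + 1] g)"

end

theory Submission
  imports Defs
begin

text \<open>
  Differentiating Gegenbauer polynomials in homogeneous form gives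
  \<open>\<partial>\<^bsub>x\<^sub>r\<^esub> F\<^bsub>r,j\<^esub>\<^bsup>(n)\<^esup> = (j + n) F\<^bsub>r,j\<^esub>\<^bsup>(n-1)\<^esup>\<close>, and the factors \<open>X\<close> inherit the same rule. In the
  operator \<open>X\<^bsup>s,t,r\<^esup>\<^bsub>k,j\<^esub>\<close> both summands then acquire the same factor \<open>j + (k - j) =
  (j + 1) + (k - 1 - j) = k\<close>, because everything else is independent of \<open>x\<^sub>r\<close>. Since
  \<open>X\<^bsup>s,t,r\<^esup>\<^bsub>j,j\<^esub>\<close> is multiplication by a power of \<open>e\<^sub>r\<close>, differentiating \<open>k - j\<close> times leaves
  \<open>k! / j!\<close> times that power, and the factorials telescope over \<open>r\<close>. In the plane both choices of
  scalars are treated at once: \<open>f\<close> is a power of \<open>x\<^sub>1 - J x\<^sub>2\<close> with \<open>J\<^sup>2 = -1\<close>, and \<open>J\<close> commutes with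
  \<open>e\<^sub>r\<close> for \<open>r \<ge> 3\<close>.
\<close>

section \<open>The Gegenbauer polynomials in homogeneous form\<close>

text \<open>Extended by zero to \<open>2 * i > n\<close>, so that sums may run over all
  \<open>i \<le> n\<close> and the shifted recursion below holds for every \<open>i\<close>.\<close>

definition gegenbauer_coeff :: "nat \<Rightarrow> real \<Rightarrow> nat \<Rightarrow> real" where
  "gegenbauer_coeff n a i =
     (if 2 * i \<le> n then (-1) ^ i * pochhammer a (n - i) / (fact i * fact (n - 2 * i)) else 0)"

text \<open>With \<open>q = \<rho>\<^sup>2\<close> this is
  \<open>\<rho> ^ n * gegenbauer n a (z / \<rho>)\<close> as a polynomial in \<open>z\<close> and
  \<open>q\<close>: no root and no division, hence smooth at the origin too.\<close>

definition gegenbauer_hom :: "nat \<Rightarrow> real \<Rightarrow> real \<Rightarrow> real \<Rightarrow> real" where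
  "gegenbauer_hom n a q z = (\<Sum>i\<le>n. gegenbauer_coeff n a i * (2 * z) ^ (n - 2 * i) * q ^ i)"

lemma gegenbauer_hom_eq:
  assumes "\<rho> = 0 \<Longrightarrow> z = 0"
  shows "\<rho> ^ n * gegenbauer n a (z / \<rho>) = gegenbauer_hom n a (\<rho>\<^sup>2) z"
proof -
  have "\<rho> ^ n * gegenbauer n a (z / \<rho>) =
      (\<Sum>i = 0..n div 2. gegenbauer_coeff n a i * (2 * z) ^ (n - 2 * i) * (\<rho>\<^sup>2) ^ i)"
    unfolding gegenbauer_def sum_distrib_left
  proof (rule sum.cong[OF refl])
    fix i assume "i \<in> {0..n div 2}"
    then have i: "2 * i \<le> n" by auto
    then obtain d where d: "n = 2 * i + d" using le_Suc_ex by blast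
    have "\<rho> ^ n * (2 * (z / \<rho>)) ^ d = (2 * z) ^ d * (\<rho>\<^sup>2) ^ i"
    \<comment> \<open>If \<open>\<rho> = 0\<close> then also \<open>z = 0\<close>, and both sides
      are 1 for \<open>n = 0\<close> and 0 otherwise.\<close>
    proof (cases "\<rho> = 0")
      case True
      with assms show ?thesis by (auto simp: d power_mult[symmetric] power_0_left)
    next
      case False
      then show ?thesis
        by (simp add: d power_add power_mult power_mult_distrib power_divide)
    qed
    moreover have "n - 2 * i = d" by (simp add: d)
    ultimately show "\<rho> ^ n * ((-1) ^ i * pochhammer a (n - i) / (fact i * fact (n - 2 * i))
        * (2 * (z / \<rho>)) ^ (n - 2 * i))
      = gegenbauer_coeff n a i * (2 * z) ^ (n - 2 * i) * (\<rho>\<^sup>2) ^ i"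
      unfolding gegenbauer_coeff_def using i by (simp only: if_True) (metis mult.assoc mult.left_commute)
  qed
  also have "\<dots> = gegenbauer_hom n a (\<rho>\<^sup>2) z"
    unfolding gegenbauer_hom_def
    by (rule sum.mono_neutral_left) (auto simp: gegenbauer_coeff_def)
  finally show ?thesis .
qed

text \<open>Compares the coefficients of \<open>(2 * z) ^ (n - 2 * i) * q ^ i\<close> in the
  derivative formula below: the first term comes from a power of \<open>z\<close>, the second from a
  power of \<open>q\<close>. Without the common factor it reads
  \<open>2 * (a + n - i) - (n - 2 * i) = 2 * a + n\<close>.\<close>

lemma gegenbauer_coeff_rec:
  "2 * (real (Suc n) - 2 * real i) * gegenbauer_coeff (Suc n) a i
     + (real i + 1) * gegenbauer_coeff (Suc n) a (Suc i) = (2 * a + real n) * gegenbauer_coeff n a i"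
proof (cases "2 * i \<le> n")
  case False
  then have "gegenbauer_coeff (Suc n) a (Suc i) = 0" "gegenbauer_coeff n a i = 0"
    \<comment> \<open>At \<open>2 * i = Suc n\<close> the coefficient need not vanish, but the
      factor in front of it does.\<close>
    and "real (Suc n) = 2 * real i \<or> gegenbauer_coeff (Suc n) a i = 0"
    by (auto simp: gegenbauer_coeff_def)
  then show ?thesis by auto
next
  case True
  then obtain d where d: "n = 2 * i + d" using le_Suc_ex by blast
  have s: "Suc n - i = Suc (i + d)" "n - i = i + d" "Suc n - 2 * i = Suc d" "n - 2 * i = d"
    "Suc n - Suc i = i + d" "Suc n - 2 * Suc i = d - 1"
    by (simp_all add: d)
  show ?thesis
  \<comment> \<open>For \<open>d = 0\<close> the exponent \<open>d - 1\<close> is truncated, but the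
    coefficient at \<open>Suc i\<close> is then zero.\<close>
  proof (cases d)
    case 0
    then show ?thesis
      unfolding gegenbauer_coeff_def s by (simp add: d pochhammer_Suc field_simps)
  next
    case (Suc d')
    have "2 * i \<le> n" "2 * Suc i \<le> Suc n" "2 * i \<le> Suc n" by (simp_all add: d Suc)
    then show ?thesis
      unfolding gegenbauer_coeff_def s
      by (simp add: d Suc pochhammer_Suc divide_simps) (simp add: algebra_simps)
  qed
qed

lemma gegenbauer_hom_deriv:
  assumes q: "\<And>u. q u = c + u\<^sup>2"
  shows "((\<lambda>u. gegenbauer_hom (Suc n) a (q u) u) has_real_derivative
      (2 * a + real n) * gegenbauer_hom n a (q z) z) (at z)"
proof -
  let ?c = "gegenbauer_coeff (Suc n) a"
  \<comment> \<open>\<open>?A i\<close> arises from differentiating the power of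
    \<open>2 * u\<close>, \<open>?B i\<close> from the power of \<open>q u\<close>, whose derivative
    is \<open>2 * u\<close>.\<close>
  let ?A = "\<lambda>i. 2 * (real (Suc n) - 2 * real i) * ?c i * (2 * z) ^ (n - 2 * i) * q z ^ i"
  let ?B = "\<lambda>i. real i * ?c i * (2 * z) ^ (Suc n - 2 * i) * (2 * z) * q z ^ (i - 1)"
  have deriv: "((\<lambda>u. ?c i * (2 * u) ^ (Suc n - 2 * i) * q u ^ i) has_real_derivative
      ?A i + ?B i) (at z)" for i
  proof -
    consider d where "n = 2 * i + d" | "Suc n = 2 * i" | "Suc n < 2 * i"
      by (metis le_Suc_ex linorder_cases not_less_eq_eq less_Suc_eq_le)
    then show ?thesis
    proof cases
      case (1 d)
      then have eqs: "Suc n - 2 * i = Suc d" "n - 2 * i = d" "real (Suc n) = 2 * real i + real (Suc d)"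
        by simp_all
      show ?thesis
        unfolding q eqs by (rule derivative_eq_intros refl)+ (simp add: algebra_simps)
    next
      case 2
      then have "Suc n - 2 * i = 0" "n - 2 * i = 0" "real (Suc n) = 2 * real i"
        by simp_all
      then show ?thesis
        unfolding q by (auto intro!: derivative_eq_intros simp: algebra_simps)
    qed (simp add: gegenbauer_coeff_def)
  qed
  \<comment> \<open>Shifting the index in \<open>?B\<close> makes \<open>?A i\<close> and
    \<open>?B (Suc i)\<close> multiples of the same monomial; the two end terms left over
    vanish.\<close>
  have "(\<Sum>i\<le>Suc n. ?A i + ?B i) = (\<Sum>i\<le>n. ?A i + ?B (Suc i))"
  proof -
    have "?A (Suc n) = 0" by (simp add: gegenbauer_coeff_def)
    moreover have "?B 0 = 0" by simp
    ultimately show ?thesis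
      unfolding sum.distrib sum.atMost_Suc[of ?A] sum.atMost_Suc_shift[of ?B] by simp
  qed
  also have "\<dots> = (2 * a + real n) * gegenbauer_hom n a (q z) z"
    unfolding gegenbauer_hom_def sum_distrib_left
  proof (rule sum.cong[OF refl])
    fix i
    have B: "?B (Suc i) = (real i + 1) * ?c (Suc i) * (2 * z) ^ (n - 2 * i) * q z ^ i"
    proof (cases "2 * Suc i \<le> Suc n")
      case True
      then have "n - 2 * i = Suc (Suc n - 2 * Suc i)" by simp
      then have "(2 * z) ^ (n - 2 * i) = (2 * z) ^ (Suc n - 2 * Suc i) * (2 * z)"
        by (metis power_Suc2)
      then show ?thesis by (simp add: mult.assoc add.commute)
    qed (simp add: gegenbauer_coeff_def)
    have "?A i + (real i + 1) * ?c (Suc i) * (2 * z) ^ (n - 2 * i) * q z ^ i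
        = (2 * a + real n) * (gegenbauer_coeff n a i * (2 * z) ^ (n - 2 * i) * q z ^ i)"
      unfolding mult.assoc[symmetric] gegenbauer_coeff_rec[symmetric]
      by (simp only: distrib_right)
    then show "?A i + ?B (Suc i)
        = (2 * a + real n) * (gegenbauer_coeff n a i * (2 * z) ^ (n - 2 * i) * q z ^ i)"
      by (subst B)
  qed
  finally have eq: "(\<Sum>i\<le>Suc n. ?A i + ?B i) = (2 * a + real n) * gegenbauer_hom n a (q z) z" .
  show ?thesis
    unfolding eq[symmetric] gegenbauer_hom_def[of "Suc n"] by (intro DERIV_sum deriv)
qed


section \<open>Derivatives of the embedding factors\<close>

text \<open>The polynomial form in which \<open>F\<close> can be differentiated. It covers the
  origin because \<open>radius r x = 0\<close> forces \<open>x r = 0\<close>.\<close>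

lemma F_of_nat:
  assumes "r \<ge> 1"
  shows "F r j (int n) x = pochhammer (real j + 1) n / pochhammer (real r - 2 + 2 * real j) n
     * gegenbauer_hom n (real r / 2 + real j - 1) (\<Sum>i = 1..r. (x i)\<^sup>2) (x r)"
proof -
  have q: "0 \<le> (\<Sum>i = 1..r. (x i)\<^sup>2)" by (simp add: sum_nonneg)
  have "x r = 0" if "radius r x = 0"
    using that assms sum_nonneg_eq_0_iff[of "{1..r}" "\<lambda>i. (x i)\<^sup>2"] by (auto simp: radius_def)
  from gegenbauer_hom_eq[OF this, where n = n and a = "real r / 2 + real j - 1"] show ?thesis
    using q by (simp add: F_def mult.assoc) (simp add: radius_def)
qed

lemma F_negative: "n < 0 \<Longrightarrow> F r j n x = 0"
  by (simp add: F_def)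

lemma F_0: "F r j 0 x = 1"
  by (simp add: F_def gegenbauer_def)

text \<open>The factor \<open>2 * a + k\<close> from the Gegenbauer derivative, with
  \<open>2 * a = r - 2 + 2 * j\<close> and \<open>n = k + 1\<close>, cancels the last factor of the
  lower Pochhammer symbol; the last factor of the upper one, \<open>j + n\<close>, remains.\<close>

lemma F_deriv:
  assumes "r \<ge> 3"
  shows "((\<lambda>u. F r j n (x(r := u))) has_real_derivative (real j + of_int n) * F r j (n - 1) x)
    (at (x r))"
proof -
  consider "n < 0" | "n = 0" | k where "n = int (Suc k)"
    by (metis nonneg_int_cases not_less not0_implies_Suc of_nat_0)
  then show ?thesis
  proof cases
    case 3
    define a where "a = real r / 2 + real j - 1"
    let ?p = "\<lambda>n. pochhammer (real j + 1) n / pochhammer (2 * a) n"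
    have a: "real r - 2 + 2 * real j = 2 * a" by (simp add: a_def)
    define q where "q = (\<lambda>u. (\<Sum>i = 1..r-1. (x i)\<^sup>2) + u\<^sup>2)"
    have r: "{1..r} = insert r {1..r-1}" using assms by auto
    have "(\<Sum>i = 1..r-1. ((x(r := u)) i)\<^sup>2) = (\<Sum>i = 1..r-1. (x i)\<^sup>2)" for u
      using assms by (intro sum.cong) auto
    then have q: "(\<Sum>i = 1..r. ((x(r := u)) i)\<^sup>2) = q u" for u
      unfolding r q_def using assms by (subst sum.insert) auto
    have Fk: "F r j (int k) (x(r := u)) = ?p k * gegenbauer_hom k a (q u) u" for k u
      using assms by (subst F_of_nat) (simp_all only: q a a_def fun_upd_same)
    have "((\<lambda>u. F r j n (x(r := u))) has_real_derivative
        ?p (Suc k) * ((2 * a + real k) * gegenbauer_hom k a (q (x r)) (x r))) (at (x r))"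
      unfolding 3 Fk by (intro DERIV_cmult gegenbauer_hom_deriv) (simp add: q_def)
    \<comment> \<open>Here \<open>r \<ge> 3\<close> makes \<open>a\<close> positive, so the
      cancelled denominators are nonzero.\<close>
    moreover have "2 * a + real k \<noteq> 0" "pochhammer (2 * a) k \<noteq> 0"
      using assms pochhammer_pos[of "2 * a" k] by (auto simp: a_def)
    then have "?p (Suc k) * ((2 * a + real k) * y) = (real j + of_int n) * (?p k * y)" for y
      by (simp add: 3 pochhammer_Suc divide_simps)
    moreover have "F r j (n - 1) x = ?p k * gegenbauer_hom k a (q (x r)) (x r)"
      using Fk[of k "x r"] 3 by simp
    ultimately show ?thesis by simp
  qed (simp_all add: F_negative F_0)
qed

lemma F_upd: "r < i \<Longrightarrow> F r j n (x(i := u)) = F r j n x"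
  by (simp add: F_def radius_def)

lemma vec1_upd: "r < i \<Longrightarrow> vec1 r (x(i := u)) = vec1 r x"
  by (simp add: vec1_def)

lemma X_eq:
  "X r j n x = of_real (F r j n x)
     + ((real j + 1) / (real r + 2 * real j - 1) * F r (j + 1) (n - 1) x) *\<^sub>R (vec1 (r - 1) x * e r)"
  by (simp add: X_def F_negative)

lemma X_upd: "r < i \<Longrightarrow> X r j n (x(i := u)) = X r j n x"
  by (simp add: X_eq F_upd vec1_upd)

lemma X_negative: "n < 0 \<Longrightarrow> X r j n x = 0"
  by (simp add: X_def)

lemma X_0: "X r j 0 x = 1"
  by (simp add: X_eq F_0 F_negative)

text \<open>The second summand raises \<open>j\<close> and lowers \<open>n\<close> by one, so both
  summands receive the factor \<open>j + n\<close>; \<open>vec1 (r - 1)\<close> does not involve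
  \<open>x r\<close>.\<close>

lemma X_deriv:
  assumes "r \<ge> 3"
  shows "((\<lambda>u. X r j n (x(r := u)) :: 'k::real_normed_field clifford) has_vector_derivative
    (real j + of_int n) *\<^sub>R X r j (n - 1) x) (at (x r))"
proof -
  let ?c = "(real j + 1) / (real r + 2 * real j - 1)"
  have eq: "X r j n (x(r := u)) = F r j n (x(r := u)) *\<^sub>R 1
      + (?c * F r (j + 1) (n - 1) (x(r := u))) *\<^sub>R (vec1 (r - 1) x * e r :: 'k clifford)" for u
    unfolding X_eq using assms by (simp add: vec1_upd of_real_def)
  have "((\<lambda>u. X r j n (x(r := u)) :: 'k clifford) has_vector_derivative
     ((real j + of_int n) * F r j (n - 1) x) *\<^sub>R 1
     + (?c * ((real (j + 1) + of_int (n - 1)) * F r (j + 1) (n - 1 - 1) x))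
         *\<^sub>R (vec1 (r - 1) x * e r)) (at (x r))"
    unfolding eq
    by (intro has_vector_derivative_add
        bounded_linear.has_vector_derivative[OF bounded_linear_scaleR_left]
        has_real_derivative_iff_has_vector_derivative[THEN iffD1] DERIV_cmult F_deriv assms)
  then show ?thesis
    by (rule has_vector_derivative_eq_rhs)
      (simp add: X_eq of_real_def scaleR_add_right mult.commute mult.left_commute)
qed

section \<open>Partial derivatives of the embedding operators\<close>

text \<open>\<open>partial\<close> returns some value even where no derivative exists; this relation
  also asserts differentiability at every point, which the product rules require.\<close>

definition has_partial :: "nat \<Rightarrow> 'k::real_normed_field cfun \<Rightarrow> 'k cfun \<Rightarrow> bool" where
  "has_partial i g g' \<longleftrightarrow>
     (\<forall>x. ((\<lambda>t. g (x(i := t))) has_vector_derivative g' x) (at (x i)))"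

lemma partial_eq: "has_partial i g g' \<Longrightarrow> partial i g = g'"
  by (auto simp: has_partial_def partial_def intro!: vector_derivative_at)

lemma has_partial_cmult: "has_partial i g g' \<Longrightarrow> has_partial i (\<lambda>x. c * g x) (\<lambda>x. c * g' x)"
  by (auto simp: has_partial_def intro!: has_vector_derivative_mult_right)

lemma has_partial_mult_const: "has_partial i g g' \<Longrightarrow> has_partial i (\<lambda>x. g x * c) (\<lambda>x. g' x * c)"
  by (auto simp: has_partial_def intro!: has_vector_derivative_mult_left)

lemma has_partial_const: "(\<And>x u. g (x(i := u)) = g x) \<Longrightarrow> has_partial i g (\<lambda>x. 0)"
  by (simp add: has_partial_def)

lemma has_partial_embed:
  assumes "r \<ge> 3" "k \<ge> 1" and g: "\<And>x u. g (x(r := u)) = g x"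
  shows "has_partial r (embed s t r k j g) (\<lambda>x. of_nat k * embed s t r (k - 1) j g x)"
  unfolding has_partial_def
proof
  fix x
  \<comment> \<open>\<open>c\<close> and \<open>d\<close> gather everything independent of
    \<open>x r\<close>, so only the two \<open>X\<close> factors are differentiated.\<close>
  define c where "c = e r ^ nat (s - t) * g x"
  define w where "w = e r ^ nat (s - t + 1) * g x"
  define d where "d = (\<beta>_coeff r t j powi (t - s)) *\<^sub>R wedge (vec1 (r - 1) x) w
      + (\<beta>_coeff r t j powi (t - s + 1)) *\<^sub>R bullet (vec1 (r - 1) x) w"
  have k: "embed s t r k j g (x(r := u)) = X r j (int k - int j) (x(r := u)) * c
     + \<alpha>_coeff r t j *\<^sub>R (X r (j + 1) (int k - 1 - int j) (x(r := u)) * d)" for k u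
    using assms by (simp add: embed_def Let_def c_def w_def d_def g vec1_upd)
  have "((\<lambda>u. embed s t r k j g (x(r := u))) has_vector_derivative
     ((real j + of_int (int k - int j)) *\<^sub>R X r j (int k - int j - 1) x) * c
     + \<alpha>_coeff r t j *\<^sub>R (((real (j + 1) + of_int (int k - 1 - int j))
          *\<^sub>R X r (j + 1) (int k - 1 - int j - 1) x) * d)) (at (x r))"
    unfolding k
    by (intro has_vector_derivative_add has_vector_derivative_mult_left
        bounded_linear.has_vector_derivative[OF bounded_linear_scaleR_right] X_deriv assms)
  moreover have "real j + of_int (int k - int j) = real k"
    "real (j + 1) + of_int (int k - 1 - int j) = real k" by simp_all
  moreover have "embed s t r (k - 1) j g x = X r j (int k - int j - 1) x * c
     + \<alpha>_coeff r t j *\<^sub>R (X r (j + 1) (int k - 1 - int j - 1) x * d)"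
  proof -
    \<comment> \<open>\<open>k \<ge> 1\<close> rules out truncation.\<close>
    have "int (k - 1) = int k - 1" using assms by simp
    then have "int (k - 1) - int j = int k - int j - 1"
      "int (k - 1) - 1 - int j = int k - 1 - int j - 1" by simp_all
    with k[of "k - 1" "x r"] show ?thesis by (simp only: fun_upd_triv)
  qed
  moreover have "of_nat k * y = real k *\<^sub>R y" for y :: "'a clifford"
    by (simp only: scaleR_conv_of_real of_real_of_nat_eq)
  ultimately show "((\<lambda>u. embed s t r k j g (x(r := u))) has_vector_derivative
      of_nat k * embed s t r (k - 1) j g x) (at (x r))"
    by (simp only: mult_scaleR_left scaleR_add_right) (simp only: scaleR_left_commute)
qed

text \<open>The first factor \<open>X\<close> has degree 0 and equals 1; the second has degree -1
  and vanishes.\<close>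

lemma embed_diag: "embed s t r k k g = (\<lambda>x. e r ^ nat (s - t) * g x)"
  by (simp add: embed_def Let_def X_0 X_negative)

lemma embed_upd:
  assumes "r < i" "\<And>x u. g (x(i := u)) = g x"
  shows "embed s t r k j g (x(i := u)) = embed s t r k j g x"
  using assms by (simp add: embed_def X_upd vec1_upd)

text \<open>The successive factors \<open>j + n, ..., j + 1\<close> multiply to
  \<open>fact (j + n) / fact j\<close>, and the last derivative reaches the diagonal case. The left
  factor \<open>c\<close> is arbitrary so that it can absorb these numbers and, later, the powers of
  outer generators.\<close>

lemma iterated_partial_embed:
  assumes "r \<ge> 3" and g: "\<And>x u. g (x(r := u)) = g x"
  shows "(partial r ^^ n) (\<lambda>x. c * embed s t r (j + n) j g x)
    = (\<lambda>x. ((fact (j + n) / fact j) *\<^sub>R c) * (e r ^ nat (s - t) * g x))"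
proof (induction n arbitrary: c)
  case 0
  then show ?case by (simp add: embed_diag)
next
  case (Suc n)
  have "partial r (\<lambda>x. c * embed s t r (j + Suc n) j g x)
      = (\<lambda>x. c * (of_nat (j + Suc n) * embed s t r (j + Suc n - 1) j g x))"
    by (intro partial_eq has_partial_cmult has_partial_embed assms) simp
  also have "\<dots> = (\<lambda>x. (real (j + Suc n) *\<^sub>R c) * embed s t r (j + n) j g x)"
  proof
    fix x
    have "of_nat (j + Suc n) * y = real (j + Suc n) *\<^sub>R y" for y :: "'a clifford"
      by (simp only: scaleR_conv_of_real of_real_of_nat_eq)
    then show "c * (of_nat (j + Suc n) * embed s t r (j + Suc n - 1) j g x)
        = (real (j + Suc n) *\<^sub>R c) * embed s t r (j + n) j g x"
      by (simp only: mult_scaleR_left mult_scaleR_right add_Suc_right diff_Suc_1)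
  qed
  finally have *: "partial r (\<lambda>x. c * embed s t r (j + Suc n) j g x)
      = (\<lambda>x. (real (j + Suc n) *\<^sub>R c) * embed s t r (j + n) j g x)" .
  show ?case
    unfolding funpow_Suc_right o_apply * Suc.IH by (simp add: mult.commute del: of_nat_Suc)
qed


section \<open>The planar case\<close>

text \<open>The product rule keeps the order of factors; commutation at the point \<open>u\<close>
  lets the terms be collected.\<close>

lemma has_vector_derivative_power_commuting:
  fixes z :: "real \<Rightarrow> 'a::real_normed_algebra_1"
  assumes "(z has_vector_derivative w) (at u)" "w * z u = z u * w"
  shows "((\<lambda>u. z u ^ Suc n) has_vector_derivative of_nat (Suc n) * w * z u ^ n) (at u)"
proof (induction n)
  case 0
  then show ?case using assms by simp
next
  case (Suc n)
  have "z u * (of_nat (Suc n) * w * z u ^ n) = of_nat (Suc n) * (z u * w) * z u ^ n"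
    by (metis mult.assoc mult_of_nat_commute)
  then have "z u * (of_nat (Suc n) * w * z u ^ n) = of_nat (Suc n) * w * (z u * z u ^ n)"
    by (simp only: assms(2)[symmetric] mult.assoc)
  with has_vector_derivative_mult[OF assms(1) Suc] show ?case
    by (simp add: algebra_simps)
qed

text \<open>\<open>J\<close> acts as an imaginary unit and \<open>D\<close> as the complex
  derivative in \<open>x 1 - J * x 2\<close>. The factor \<open>E\<close> holds what the outer
  derivatives leave on the left; since it commutes with \<open>J\<close>, the operator passes
  through it.\<close>

lemma iterated_planar_derivative:
  fixes J E v :: "'k::real_normed_field clifford"
  assumes J: "J * J = -1" and E: "E * J = J * E"
  defines "D \<equiv> \<lambda>g x. (1/2) *\<^sub>R (partial 1 g x + J * partial 2 g x)"
  shows "(D ^^ l) (\<lambda>x. E * ((of_real (x 1) - J * of_real (x 2)) ^ l * v))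
    = (\<lambda>x. fact l * (E * v))"
  using E
proof (induction l arbitrary: E)
  case 0
  then show ?case by simp
next
  case (Suc l)
  define z where "z = (\<lambda>x :: nat \<Rightarrow> real. of_real (x 1) - J * of_real (x 2))"
  have zJ: "z x * J = J * z x" for x
    by (simp add: z_def algebra_simps of_real_def)
  have "has_partial 1 (\<lambda>x. z x ^ Suc l) (\<lambda>x. of_nat (Suc l) * 1 * z x ^ l)"
    unfolding has_partial_def
  proof
    fix x
    have "((\<lambda>u. z (x(1 := u))) has_vector_derivative 1) (at (x 1))"
      by (auto simp: z_def intro!: derivative_eq_intros)
    then show "((\<lambda>u. z (x(1 := u)) ^ Suc l) has_vector_derivative of_nat (Suc l) * 1 * z x ^ l) (at (x 1))"
      using has_vector_derivative_power_commuting[of "\<lambda>u. z (x(1 := u))"] by fastforce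
  qed
  from partial_eq[OF has_partial_cmult[OF has_partial_mult_const[OF this]]]
  have p1: "partial 1 (\<lambda>x. E * (z x ^ Suc l * v)) = (\<lambda>x. E * (of_nat (Suc l) * 1 * z x ^ l * v))" .
  have "has_partial 2 (\<lambda>x. z x ^ Suc l) (\<lambda>x. of_nat (Suc l) * (-J) * z x ^ l)"
    unfolding has_partial_def
  proof
    fix x
    have "((\<lambda>u. z (x(2 := u))) has_vector_derivative - J) (at (x 2))"
      by (auto simp: z_def intro!: derivative_eq_intros)
    then show "((\<lambda>u. z (x(2 := u)) ^ Suc l) has_vector_derivative of_nat (Suc l) * (-J) * z x ^ l) (at (x 2))"
      using has_vector_derivative_power_commuting[of "\<lambda>u. z (x(2 := u))" "-J" "x 2"] zJ[of x] by simp
  qed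
  from partial_eq[OF has_partial_cmult[OF has_partial_mult_const[OF this]]]
  have p2: "partial 2 (\<lambda>x. E * (z x ^ Suc l * v)) = (\<lambda>x. E * (of_nat (Suc l) * (-J) * z x ^ l * v))" .
  have JJ: "J * (J * y) = - y" for y
    by (simp add: J flip: mult.assoc)
  \<comment> \<open>\<open>J\<close> moves past \<open>E\<close> and meets \<open>- J\<close>, with
    product 1: both partial derivatives contribute equally, and the factor 1/2 averages
    them.\<close>
  have "J * (E * (of_nat (Suc l) * (-J) * z x ^ l * v)) = E * (of_nat (Suc l) * z x ^ l * v)" for x
  proof -
    have "J * (E * (of_nat (Suc l) * (-J) * z x ^ l * v)) = E * (J * (of_nat (Suc l) * (-J) * z x ^ l * v))"
      by (simp only: Suc.prems flip: mult.assoc)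
    also have "J * (of_nat (Suc l) * (-J) * z x ^ l * v) = of_nat (Suc l) * (J * (- J * (z x ^ l * v)))"
      by (metis mult.assoc mult_of_nat_commute)
    finally show ?thesis by (simp only: minus_mult_left[symmetric] minus_mult_right[symmetric] JJ minus_minus mult.assoc)
  qed
  then have "D (\<lambda>x. E * (z x ^ Suc l * v)) = (\<lambda>x. E * (of_nat (Suc l) * z x ^ l * v))"
    unfolding D_def p1 p2 by (simp flip: scaleR_2)
  also have "\<dots> = (\<lambda>x. (of_nat (Suc l) * E) * (z x ^ l * v))"
    by (metis mult.assoc mult_of_nat_commute)
  finally have *: "D (\<lambda>x. E * (z x ^ Suc l * v)) = (\<lambda>x. (of_nat (Suc l) * E) * (z x ^ l * v))" .
  \<comment> \<open>The enlarged left factor still commutes with \<open>J\<close>, as the induction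
    hypothesis demands.\<close>
  have "of_nat (Suc l) * E * J = J * (of_nat (Suc l) * E)"
    by (metis Suc.prems mult.assoc mult_of_nat_commute)
  note IH = Suc.IH[OF this]
  show ?case
    unfolding funpow_Suc_right o_apply *[unfolded z_def] IH
    using mult_of_nat_commute[of "Suc l" "fact l :: 'k clifford"]
    by (simp only: fact_Suc flip: mult.assoc)
qed


section \<open>The basis polynomials\<close>

text \<open>The factors with \<open>r < n\<close> use only coordinates below \<open>n\<close>, and
  \<open>f\<close> only those below 3, so later variables see a constant.\<close>

lemma fold_embed_upd:
  assumes "\<And>i x u. 3 \<le> i \<Longrightarrow> f (x(i := u)) = f x" "3 \<le> n" "n \<le> i"
  shows "fold (\<lambda>r. embed (S r) (S (r - 1)) r (K r) (K (r - 1))) [3..<n] f (x(i := u))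
    = fold (\<lambda>r. embed (S r) (S (r - 1)) r (K r) (K (r - 1))) [3..<n] f x"
  using assms(2,3)
proof (induction n arbitrary: i x u rule: dec_induct)
  case base
  then show ?case by (simp only: upt_conv_Nil order.refl fold_simps assms(1))
next
  case (step n)
  then have "embed (S n) (S (n - 1)) n (K n) (K (n - 1))
        (fold (\<lambda>r. embed (S r) (S (r - 1)) r (K r) (K (r - 1))) [3..<n] f) (x(i := u))
      = embed (S n) (S (n - 1)) n (K n) (K (n - 1))
        (fold (\<lambda>r. embed (S r) (S (r - 1)) r (K r) (K (r - 1))) [3..<n] f) x"
    by (intro embed_upd step.IH) simp_all
  with step(1) show ?case
    by (simp only: upt_Suc if_True fold_append fold_simps o_apply)
qed

text \<open>\<open>foldr\<close> differentiates in the last variable first. This turns the outermost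
  operator into a power of its generator, which joins \<open>c\<close>, and the induction hypothesis
  treats the inner ones. The quotients of factorials telescope.\<close>

lemma iterated_partial_fold_embed:
  assumes f: "\<And>i x u. 3 \<le> i \<Longrightarrow> f (x(i := u)) = f x" and "3 \<le> n"
    and "\<And>r. r \<in> {3..<n} \<Longrightarrow> K (r - 1) \<le> K r"
  shows "foldr (\<lambda>r. partial r ^^ (K r - K (r - 1))) [3..<n]
      (\<lambda>x. c * fold (\<lambda>r. embed (S r) (S (r - 1)) r (K r) (K (r - 1))) [3..<n] f x)
    = (\<lambda>x. ((fact (K (n - 1)) / fact (K 2)) *\<^sub>R c)
        * fold (\<lambda>r v. e r ^ nat (S r - S (r - 1)) * v) [3..<n] (f x))"
  using assms(2,3)
proof (induction n arbitrary: c rule: dec_induct)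
  case base
  then show ?case by simp
next
  case (step n)
  let ?g = "fold (\<lambda>r. embed (S r) (S (r - 1)) r (K r) (K (r - 1))) [3..<n] f"
  \<comment> \<open>By monotonicity of \<open>K\<close> the order of differentiation is a genuine
    difference.\<close>
  have "K n = K (n - 1) + (K n - K (n - 1))" using step by simp
  then have "(partial n ^^ (K n - K (n - 1)))
      (\<lambda>x. c * embed (S n) (S (n - 1)) n (K n) (K (n - 1)) ?g x)
    = (\<lambda>x. ((fact (K n) / fact (K (n - 1))) *\<^sub>R c) * (e n ^ nat (S n - S (n - 1)) * ?g x))"
    using iterated_partial_embed[of n ?g "K n - K (n - 1)" c "S n" "S (n - 1)" "K (n - 1)"]
      fold_embed_upd[OF f step(1) order.refl] step(1) by simp
  then show ?case
    using step(1,2) step.IH[of "((fact (K n) / fact (K (n - 1))) *\<^sub>R c) * e n ^ nat (S n - S (n - 1))"]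
      step.prems
    by (simp add: mult.assoc)
qed

lemma fold_mult:
  fixes a :: "'b \<Rightarrow> 'a::monoid_mult"
  shows "fold (\<lambda>r v. a r * v) xs w = fold (\<lambda>r v. a r * v) xs 1 * w"
proof (induction xs rule: rev_induct)
  case (snoc x xs)
  then show ?case by (simp add: mult.assoc)
qed simp

lemma fold_mult_commute:
  fixes J :: "'a::monoid_mult"
  assumes "\<And>r. r \<in> set xs \<Longrightarrow> a r * J = J * a r"
  shows "fold (\<lambda>r v. a r * v) xs 1 * J = J * fold (\<lambda>r v. a r * v) xs 1"
  using assms
proof (induction xs rule: rev_induct)
  case (snoc x xs)
  then show ?case by simp (metis mult.assoc)
qed simp

lemma fact_mult_eq_scaleR: "fact n * y = fact n *\<^sub>R (y :: 'k::real_normed_field clifford)"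
  by (simp add: scaleR_conv_of_real)

text \<open>Common to both scalar fields: \<open>J t\<close> will be \<open>e 1 * e 2\<close> over
  the reals and plus or minus the imaginary unit over the complex numbers.\<close>

lemma basis_poly_derivatives:
  fixes f2 :: "int \<Rightarrow> nat \<Rightarrow> 'k::real_normed_field cfun"
  assumes m: "m \<ge> 3" and I: "(\<nu>, \<mu>) \<in> I_index m s k"
    and f2: "\<And>t l i x u. 3 \<le> i \<Longrightarrow> f2 t l (x(i := u)) = f2 t l x"
    and planar: "\<And>t. t \<in> {0, 2} \<Longrightarrow> f2 t 0 = (\<lambda>x. e2 t)"
      "\<And>t l. t \<in> {1, -1} \<Longrightarrow> f2 t l = (\<lambda>x. (of_real (x 1) - J t * of_real (x 2)) ^ l * e2 t)"
      "\<And>t. t \<in> {1, -1} \<Longrightarrow> d2 t = (\<lambda>g x. (1/2) *\<^sub>R (partial 1 g x + J t * partial 2 g x))"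
    and J: "\<And>t. t \<in> {1, -1} \<Longrightarrow> J t * J t = -1" "\<And>t r. 3 \<le> r \<Longrightarrow> e r * J t = J t * e r"
  shows "(k = \<mu> (m - 1) \<longrightarrow> partial m (basis_poly f2 m s k \<nu> \<mu>) = (\<lambda>x. 0)) \<and>
    (k > \<mu> (m - 1) \<longrightarrow> partial m (basis_poly f2 m s k \<nu> \<mu>)
       = (\<lambda>x. of_nat k * basis_poly f2 m s (k - 1) \<nu> \<mu> x)) \<and>
    iterated_deriv d2 m k \<nu> \<mu> (basis_poly f2 m s k \<nu> \<mu>) = (\<lambda>x. fact k * basis_vector e2 m s \<nu>)"
proof (intro conjI impI)
  define S where "S = s_at m s \<nu>"
  let ?B = "\<lambda>k n. fold (\<lambda>r. embed (S r) (S (r - 1)) r (k_at m k \<mu> r) (k_at m k \<mu> (r - 1)))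
    [3..<n] (f2 (\<nu> 2) (\<mu> 2))"
  \<comment> \<open>The degree \<open>k\<close> enters only the outermost operator, so the inner
    part is shared with degree \<open>k - 1\<close>.\<close>
  have "?B k m = ?B (k - 1) m"
    by (rule fold_cong) (auto simp: k_at_def)
  moreover have B: "basis_poly f2 m s k \<nu> \<mu> = embed s (S (m - 1)) m k (\<mu> (m - 1)) (?B k m)" for k
  proof -
    have "m - Suc 0 \<noteq> m" using m by simp
    then show ?thesis using m by (simp add: basis_poly_def k_at_def S_def s_at_def)
  qed
  moreover have upd: "?B k m (x(m := u)) = ?B k m x" for x u
    using fold_embed_upd[of "f2 (\<nu> 2) (\<mu> 2)" m m S "k_at m k \<mu>", OF f2 m order.refl] .
  ultimately show "partial m (basis_poly f2 m s k \<nu> \<mu>)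
      = (\<lambda>x. of_nat k * basis_poly f2 m s (k - 1) \<nu> \<mu> x)" if "k > \<mu> (m - 1)"
    using m that by (simp only: B) (intro partial_eq has_partial_embed, auto)
  \<comment> \<open>The outermost operator is now multiplication by a power of \<open>e m\<close>,
    so nothing depends on \<open>x m\<close>.\<close>
  show "partial m (basis_poly f2 m s k \<nu> \<mu>) = (\<lambda>x. 0)" if "k = \<mu> (m - 1)"
    unfolding B that[symmetric] embed_diag using upd
    by (intro partial_eq has_partial_const) (simp add: that[symmetric])
  \<comment> \<open>\<open>N_index\<close> bounds the lower degree by the upper one.\<close>
  have K: "k_at m k \<mu> (r - 1) \<le> k_at m k \<mu> r" if "r \<in> {3..<m + 1}" for r
    using I that by (auto simp: I_index_def N_index_def split: if_splits)
  define E :: "'k clifford" where "E = fold (\<lambda>r v. e r ^ nat (S r - S (r - 1)) * v) [3..<m + 1] 1"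
  have ev: "basis_vector e2 m s \<nu> = E * e2 (\<nu> 2)"
    unfolding basis_vector_def E_def S_def by (rule fold_mult)
  have E: "fold (\<lambda>r v. e r ^ nat (S r - S (r - 1)) * v) [3..<m + 1] v = E * v" for v
    unfolding E_def by (rule fold_mult)
  have "foldr (\<lambda>r. partial r ^^ (k_at m k \<mu> r - k_at m k \<mu> (r - 1))) [3..<m + 1]
      (basis_poly f2 m s k \<nu> \<mu>)
    = (\<lambda>x. ((fact k / fact (\<mu> 2)) *\<^sub>R E) * f2 (\<nu> 2) (\<mu> 2) x)"
    using iterated_partial_fold_embed[where f = "f2 (\<nu> 2) (\<mu> 2)" and n = "m + 1" and c = 1
        and S = S and K = "k_at m k \<mu>", OF f2 _ K] m
    unfolding E basis_poly_def S_def[symmetric] by (simp add: k_at_def)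
  then have "iterated_deriv d2 m k \<nu> \<mu> (basis_poly f2 m s k \<nu> \<mu>)
      = (d2 (\<nu> 2) ^^ \<mu> 2) (\<lambda>x. ((fact k / fact (\<mu> 2)) *\<^sub>R E) * f2 (\<nu> 2) (\<mu> 2) x)"
    by (simp only: iterated_deriv_def)
  also have "\<dots> = (\<lambda>x. fact k * (E * e2 (\<nu> 2)))"
  proof (cases "\<nu> 2 \<in> {0, 2}")
    case True
    with I have "\<mu> 2 = 0" by (auto simp: I_index_def)
    with True planar(1) show ?thesis
      by (simp add: fact_mult_eq_scaleR)
  next
    case False
    with I have t: "\<nu> 2 \<in> {1, -1}" by (auto simp: I_index_def)
    \<comment> \<open>\<open>E\<close> contains only generators with index at least 3, so it
      commutes with \<open>J (\<nu> 2)\<close>. The planar derivatives then yield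
      \<open>fact (\<mu> 2)\<close>, which cancels the denominator.\<close>
    have "e r ^ n * J (\<nu> 2) = J (\<nu> 2) * e r ^ n" if "3 \<le> r" for r n
      using power_commuting_commutes[OF J(2)[OF that, of "\<nu> 2"]] .
    then have "E * J (\<nu> 2) = J (\<nu> 2) * E"
      unfolding E_def by (intro fold_mult_commute) auto
    then have "((fact k / fact (\<mu> 2)) *\<^sub>R E) * J (\<nu> 2) = J (\<nu> 2) * ((fact k / fact (\<mu> 2)) *\<^sub>R E)"
      by simp
    note planar_derivative = iterated_planar_derivative[OF J(1)[OF t] this]
    show ?thesis
      by (subst planar(2)[OF t], subst planar(3)[OF t], subst planar_derivative)
        (simp add: fact_mult_eq_scaleR)
  qed
  finally show "iterated_deriv d2 m k \<nu> \<mu> (basis_poly f2 m s k \<nu> \<mu>)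
    = (\<lambda>x. fact k * basis_vector e2 m s \<nu>)" by (simp only: ev)
qed

section \<open>Relations for the two imaginary units\<close>

lemma e_swap: "i \<noteq> j \<Longrightarrow> e i * e j = - (e j * e i :: 'k::real_normed_field clifford)"
  using e_anticommute[of i j, where 'k = 'k] by (simp add: eq_neg_iff_add_eq_0)

lemma e_square: "e i * e i = (-1 :: 'k::real_normed_field clifford)"
proof -
  have "2 *\<^sub>R (e i * e i) = 2 *\<^sub>R (-1 :: 'k clifford)"
    using e_anticommute[of i i, where 'k = 'k] by (simp add: scaleR_2)
  then show ?thesis by (simp only: scaleR_cancel_left) simp
qed

lemma scalar_central: "scalar z * a = a * scalar z"
proof (rule clifford_eqI)
  fix C
  \<comment> \<open>\<open>scalar z\<close> lives on the empty blade, so only \<open>A = C\<close>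
    contributes.\<close>
  have "blade_coeff (a * scalar z) C
      = (\<Sum>A | blade_coeff a A \<noteq> 0. if A = C then blade_coeff a C * z else 0)"
    unfolding times_clifford.rep_eq scalar.rep_eq
    by (intro sum.cong) (auto simp: symdiff_eq_iff)
  also have "\<dots> = blade_coeff (scalar z * a) C"
    by (cases "z = 0") (auto simp: times_clifford.rep_eq scalar.rep_eq finite_support)
  finally show "blade_coeff (scalar z * a) C = blade_coeff (a * scalar z) C" by simp
qed

lemma scalar_mult: "scalar y * scalar z = scalar (y * z)"
  by (rule clifford_eqI) (auto simp: times_clifford.rep_eq scalar.rep_eq)

lemma scalar_minus_one: "scalar (-1) = -1"
  by (rule clifford_eqI) (simp add: scalar.rep_eq uminus_clifford.rep_eq one_clifford.rep_eq)

theorem theorem5: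
  fixes m k :: nat and s :: int and \<nu> :: "nat \<Rightarrow> int" and \<mu> :: "nat \<Rightarrow> nat"
  assumes "m \<ge> 3" and "s \<in> {0..int m}" and "(\<nu>, \<mu>) \<in> I_index m s k"
  shows "((k = \<mu> (m - 1) \<longrightarrow> partial m (basis_poly f2_real m s k \<nu> \<mu>) = (\<lambda>x. 0)) \<and>
          (k > \<mu> (m - 1) \<longrightarrow> partial m (basis_poly f2_real m s k \<nu> \<mu>)
             = (\<lambda>x. of_nat k * basis_poly f2_real m s (k - 1) \<nu> \<mu> x)) \<and>
          iterated_deriv d2_real m k \<nu> \<mu> (basis_poly f2_real m s k \<nu> \<mu>)
             = (\<lambda>x. fact k * basis_vector e2_real m s \<nu>))
         \<and>
         ((k = \<mu> (m - 1) \<longrightarrow> partial m (basis_poly f2_complex m s k \<nu> \<mu>) = (\<lambda>x. 0)) \<and>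
          (k > \<mu> (m - 1) \<longrightarrow> partial m (basis_poly f2_complex m s k \<nu> \<mu>)
             = (\<lambda>x. of_nat k * basis_poly f2_complex m s (k - 1) \<nu> \<mu> x)) \<and>
          iterated_deriv d2_complex m k \<nu> \<mu> (basis_poly f2_complex m s k \<nu> \<mu>)
             = (\<lambda>x. fact k * basis_vector e2_complex m s \<nu>))"
proof -
  have sq: "(e 1 * e 2) * (e 1 * e 2) = (-1 :: real clifford)"
  proof -
    have "(e 1 * e 2) * (e 1 * e 2) = e 1 * (e 2 * e 1) * e 2" by (simp only: mult.assoc)
    also have "e 2 * e 1 = - (e 1 * e 2 :: real clifford)" by (rule e_swap) simp
    also have "e 1 * - (e 1 * e 2) * e 2 = - ((e 1 * e 1) * (e 2 * e 2) :: real clifford)"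
      by (simp add: mult.assoc)
    finally show ?thesis by (simp add: e_square)
  qed
  \<comment> \<open>Passing two distinct generators costs two signs, which cancel.\<close>
  have comm: "e r * (e 1 * e 2) = (e 1 * e 2) * (e r :: real clifford)" if "3 \<le> r" for r
  proof -
    have "e r * (e 1 * e 2) = (e r * e 1) * (e 2 :: real clifford)" by (simp only: mult.assoc)
    also have "e r * e 1 = - (e 1 * e r :: real clifford)" using that by (intro e_swap) simp
    also have "- (e 1 * e r) * e 2 = - (e 1 * (e r * e 2) :: real clifford)"
      by (simp only: mult.assoc minus_mult_left)
    also have "e r * e 2 = - (e 2 * e r :: real clifford)" using that by (intro e_swap) simp
    finally show ?thesis by (simp add: mult.assoc)
  qed
  have sqi: "(of_int t * scalar \<i>) * (of_int t * scalar \<i>) = -1" if "t \<in> {1, -1}" for t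
    using that by (auto simp: scalar_mult scalar_minus_one)
  have commi: "e r * (of_int t * scalar \<i>) = (of_int t * scalar \<i>) * e r" for r t
    by (metis mult.assoc mult_of_int_commute scalar_central)
  show ?thesis
  proof (rule conjI)
    show "(k = \<mu> (m - 1) \<longrightarrow> partial m (basis_poly f2_real m s k \<nu> \<mu>) = (\<lambda>x. 0)) \<and>
      (k > \<mu> (m - 1) \<longrightarrow> partial m (basis_poly f2_real m s k \<nu> \<mu>)
         = (\<lambda>x. of_nat k * basis_poly f2_real m s (k - 1) \<nu> \<mu> x)) \<and>
      iterated_deriv d2_real m k \<nu> \<mu> (basis_poly f2_real m s k \<nu> \<mu>)
         = (\<lambda>x. fact k * basis_vector e2_real m s \<nu>)"
    \<comment> \<open>Over the reals the sign of \<open>t\<close> affects only the starting vector,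
      so \<open>J\<close> is constant.\<close>
    proof (rule basis_poly_derivatives[OF assms(1,3), where J = "\<lambda>t. e 1 * e 2"])
      show "d2_real t = (\<lambda>g x. (1/2) *\<^sub>R (partial 1 g x + e 1 * e 2 * partial 2 g x))"
        if "t \<in> {1, -1}" for t
        using that by (auto simp: d2_real_def fun_eq_iff)
      show "f2_real t l = (\<lambda>x. (of_real (x 1) - e 1 * e 2 * of_real (x 2)) ^ l * e2_real t)"
        if "t \<in> {1, -1}" for t l
        using that by (auto simp: f2_real_def fun_eq_iff)
    qed (auto simp only: sq comm, auto simp: f2_real_def)
    show "(k = \<mu> (m - 1) \<longrightarrow> partial m (basis_poly f2_complex m s k \<nu> \<mu>) = (\<lambda>x. 0)) \<and>
      (k > \<mu> (m - 1) \<longrightarrow> partial m (basis_poly f2_complex m s k \<nu> \<mu>)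
         = (\<lambda>x. of_nat k * basis_poly f2_complex m s (k - 1) \<nu> \<mu> x)) \<and>
      iterated_deriv d2_complex m k \<nu> \<mu> (basis_poly f2_complex m s k \<nu> \<mu>)
         = (\<lambda>x. fact k * basis_vector e2_complex m s \<nu>)"
    \<comment> \<open>Here the sign \<open>t\<close> sits in \<open>J\<close> itself; it squares to
      1, so \<open>J t\<close> still squares to -1.\<close>
    proof (rule basis_poly_derivatives[OF assms(1,3), where J = "\<lambda>t. of_int t * scalar \<i>"])
      show "d2_complex t = (\<lambda>g x. (1/2) *\<^sub>R (partial 1 g x + of_int t * scalar \<i> * partial 2 g x))"
        if "t \<in> {1, -1}" for t
        using that unfolding d2_complex_def fun_eq_iff by (subst if_not_P) auto
      show "f2_complex t l
          = (\<lambda>x. (of_real (x 1) - of_int t * scalar \<i> * of_real (x 2)) ^ l * e2_complex t)"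
        if "t \<in> {1, -1}" for t l
        using that unfolding f2_complex_def fun_eq_iff by (subst if_not_P) auto
      show "(of_int t * scalar \<i>) * (of_int t * scalar \<i>) = -1" if "t \<in> {1, -1}" for t
        using that by (rule sqi)
      show "e r * (of_int t * scalar \<i>) = (of_int t * scalar \<i>) * e r" for r t
        by (rule commi)
    qed (auto simp: f2_complex_def)
  qed
qed

end
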